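(* Let $\Lambda$ be a proper $\Lambda$-sequence and let $K\subseteq C\Lambda BV_c$ be bounded and closed with respect to the norm $\|\cdot\|_\Lambda$. Then $K$ is compact (in the norm $\|\cdot\|_\Lambda$) if and only if $\|B_nf-f\|_\Lambda\to 0$ as $n\to\infty$ uniformly for all $f\in K$.
   Context: A $\Lambda$-sequence is a nondecreasing sequence $\Lambda=(\lambda_k)_{k\ge 1}$ of positive reals with $\sum_k \frac{1}{\lambda_k}=\infty$; it is proper if $\lambda_k\to\infty$. For a closed interval $I=[a,b]\subseteq[0,1]$ and $f:[0,1]\to\mathbb{R}$ write $|f(I)|=|f(b)-f(a)|$. Closed intervals are nonoverlapping if any two of them intersect at most at endpoints. For a finite sequence $\mathcal{I}=\langle I_1,\dots,I_m\rangle$ (in any order) of nonoverlapping closed intervals contained in $[0,1]$ put $\sigma_\Lambda(f,\mathcal{I})=\sum_{k=1}^m\frac{|f(I_k)|}{\lambda_k}$. The $\Lambda$-variation of $f$ is $V_\Lambda(f)=\sup_{\mathcal{I}}\sigma_\Lambda(f,\mathcal{I})\in[0,\infty]$, the supremum being over all such finite sequences. $\Lambda BV$ is the linear space of all $f:[0,1]\to\mathbb{R}$ with $V_\Lambda(f)<\infty$, normed by $\|f\|_\Lambda=V_\Lambda(f)+|f(0)|$; it is a Banach space. For $m\ge 1$, $\Lambda_{(m)}=(\lambda_{m+1},\lambda_{m+2},\dots)$. A function $f\in\Lambda BV$ is continuous in $\Lambda$-variation if $\lim_{m\to\infty}V_{\Lambda_{(m)}}(f)=0$. $C\Lambda BV_c$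 is the set of all continuous functions $f:[0,1]\to\mathbb{R}$ that are continuous in $\Lambda$-variation. The $n$-th Bernstein polynomial of $f$, viewed as a function on $[0,1]$, is $B_nf(x)=\sum_{k=0}^n f\left(\frac{k}{n}\right)\binom{n}{k}x^k(1-x)^{n-k}$, $n\ge1$. *)

theory Defs
  imports "HOL-Analysis.Analysis"
begin

text \<open>
  Sequences are indexed from 0, so \<open>lam k\<close> stands for $\lambda_{k+1}$. Since the terms are positive,
  non-summability says that the sum of the reciprocals is infinite.
\<close>

definition Lambda_seq :: "(nat \<Rightarrow> real) \<Rightarrow> bool" where
  "Lambda_seq lam \<longleftrightarrow> (\<forall>k. 0 < lam k) \<and> incseq lam \<and> \<not> summable (\<lambda>k. 1 / lam k)"

definition proper_Lambda_seq :: "(nat \<Rightarrow> real) \<Rightarrow> bool" where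
  "proper_Lambda_seq lam \<longleftrightarrow> Lambda_seq lam \<and> filterlim lam at_top sequentially"

definition shift_seq :: "nat \<Rightarrow> (nat \<Rightarrow> real) \<Rightarrow> nat \<Rightarrow> real" where
  "shift_seq m lam = (\<lambda>k. lam (k + m))"

text \<open>
  A pair \<open>(a, b)\<close> encodes the interval \<open>{a..b}\<close>. Degenerate intervals are admitted; they contribute 0
  to the sums below and do not affect the supremum.
\<close>

definition nonoverlapping :: "(real \<times> real) list \<Rightarrow> bool" where
  "nonoverlapping I \<longleftrightarrow>
     (\<forall>(a, b) \<in> set I. 0 \<le> a \<and> a \<le> b \<and> b \<le> 1) \<and>
     (\<forall>i < length I. \<forall>j < length I. i \<noteq> j \<longrightarrow>
        {fst (I ! i)..snd (I ! i)} \<inter> {fst (I ! j)..snd (I ! j)}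
          \<subseteq> {fst (I ! i), snd (I ! i)} \<inter> {fst (I ! j), snd (I ! j)})"

definition Lambda_sum :: "(nat \<Rightarrow> real) \<Rightarrow> (real \<Rightarrow> real) \<Rightarrow> (real \<times> real) list \<Rightarrow> real" where
  "Lambda_sum lam f I = (\<Sum>k < length I. \<bar>f (snd (I ! k)) - f (fst (I ! k))\<bar> / lam k)"

definition Lambda_var :: "(nat \<Rightarrow> real) \<Rightarrow> (real \<Rightarrow> real) \<Rightarrow> ennreal" where
  "Lambda_var lam f = (SUP I \<in> {I. nonoverlapping I}. ennreal (Lambda_sum lam f I))"

text \<open>
  Functions on \<open>{0..1}\<close> are represented by the elements of \<^term>\<open>extensional {0..1::real}\<close>, so that
  equality of functions is equality on \<open>{0..1}\<close>. The variation and the norm only depend on the values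
  on \<open>{0..1}\<close>, so they may be applied to pointwise differences without restricting these again.
\<close>

definition Lambda_BV :: "(nat \<Rightarrow> real) \<Rightarrow> (real \<Rightarrow> real) set" where
  "Lambda_BV lam = {f \<in> extensional {0..1}. Lambda_var lam f < \<infinity>}"

text \<open>
  The norm is meaningful on functions of finite variation only (\<^const>\<open>enn2real\<close> sends \<open>\<infinity>\<close> to 0).
\<close>

definition Lambda_norm :: "(nat \<Rightarrow> real) \<Rightarrow> (real \<Rightarrow> real) \<Rightarrow> real" where
  "Lambda_norm lam f = enn2real (Lambda_var lam f) + \<bar>f 0\<bar>"

definition Lambda_dist :: "(nat \<Rightarrow> real) \<Rightarrow> (real \<Rightarrow> real) \<Rightarrow> (real \<Rightarrow> real) \<Rightarrow> real" where
  "Lambda_dist lam f g = Lambda_norm lam (\<lambda>x. f x - g x)"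

definition Lambda_topology :: "(nat \<Rightarrow> real) \<Rightarrow> (real \<Rightarrow> real) topology" where
  "Lambda_topology lam = Metric_space.mtopology (Lambda_BV lam) (Lambda_dist lam)"

definition continuous_in_Lambda_var :: "(nat \<Rightarrow> real) \<Rightarrow> (real \<Rightarrow> real) \<Rightarrow> bool" where
  "continuous_in_Lambda_var lam f \<longleftrightarrow>
     f \<in> Lambda_BV lam \<and> (\<lambda>m. Lambda_var (shift_seq m lam) f) \<longlonglongrightarrow> 0"

definition C_Lambda_BV_c :: "(nat \<Rightarrow> real) \<Rightarrow> (real \<Rightarrow> real) set" where
  "C_Lambda_BV_c lam =
     {f \<in> extensional {0..1}. continuous_on {0..1} f \<and> continuous_in_Lambda_var lam f}"

definition bernstein_poly :: "nat \<Rightarrow> (real \<Rightarrow> real) \<Rightarrow> real \<Rightarrow> real" where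
  "bernstein_poly n f =
     restrict (\<lambda>x. \<Sum>k\<le>n. f (real k / real n) * Bernstein n k x) {0..1}"

lemma nonoverlapping_nth:
  assumes "nonoverlapping I" "k < length I"
  shows "0 \<le> fst (I ! k)" "fst (I ! k) \<le> snd (I ! k)" "snd (I ! k) \<le> 1"
  using assms nth_mem[OF assms(2)] unfolding nonoverlapping_def by (auto simp: case_prod_beta)

lemma Lambda_var_triangle:
  assumes "\<And>k. 0 < lam k"
  shows "Lambda_var lam (\<lambda>x. f x + g x) \<le> Lambda_var lam f + Lambda_var lam g"
  unfolding Lambda_var_def
proof (rule SUP_least)
  fix I assume I: "I \<in> {I. nonoverlapping I}"
  have nn: "0 \<le> Lambda_sum lam h I" for h
    unfolding Lambda_sum_def by (intro sum_nonneg divide_nonneg_pos assms) auto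
  have "Lambda_sum lam (\<lambda>x. f x + g x) I \<le> Lambda_sum lam f I + Lambda_sum lam g I"
    unfolding Lambda_sum_def sum.distrib[symmetric] add_divide_distrib[symmetric]
    by (intro sum_mono divide_right_mono less_imp_le[OF assms]) linarith
  then have "ennreal (Lambda_sum lam (\<lambda>x. f x + g x) I)
      \<le> ennreal (Lambda_sum lam f I) + ennreal (Lambda_sum lam g I)"
    using nn by (metis ennreal_leI ennreal_plus)
  also have "\<dots> \<le> (SUP I \<in> {I. nonoverlapping I}. ennreal (Lambda_sum lam f I))
      + (SUP I \<in> {I. nonoverlapping I}. ennreal (Lambda_sum lam g I))"
    by (intro add_mono SUP_upper I)
  finally show "ennreal (Lambda_sum lam (\<lambda>x. f x + g x) I) \<le> \<dots>" .
qed

lemma Lambda_var_uminus: "Lambda_var lam (\<lambda>x. - f x) = Lambda_var lam f"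
proof -
  have "Lambda_sum lam (\<lambda>x. - f x) I = Lambda_sum lam f I" for I
    unfolding Lambda_sum_def by (intro sum.cong refl) (simp add: abs_minus_commute)
  then show ?thesis by (simp add: Lambda_var_def)
qed

lemma Lambda_var_diff_finite:
  assumes "\<And>k. 0 < lam k" "Lambda_var lam f < \<infinity>" "Lambda_var lam g < \<infinity>"
  shows "Lambda_var lam (\<lambda>x. f x - g x) < \<infinity>"
proof -
  have "Lambda_var lam (\<lambda>x. f x - g x) \<le> Lambda_var lam f + Lambda_var lam g"
    using Lambda_var_triangle[of lam f "\<lambda>x. - g x", OF assms(1)] by (simp add: Lambda_var_uminus)
  then show ?thesis using assms(2,3) by (auto simp: ennreal_add_less_top intro: le_less_trans)
qed

lemma Lambda_var_zero:
  assumes "0 < lam 0" "Lambda_var lam f = 0" "x \<in> {0..1}"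
  shows "f x = f 0"
proof -
  have no: "nonoverlapping [(0, x)]" using assms(3) by (auto simp: nonoverlapping_def)
  have "ennreal (Lambda_sum lam f [(0, x)]) \<le> Lambda_var lam f"
    unfolding Lambda_var_def by (rule SUP_upper) (use no in simp)
  then have "\<bar>f x - f 0\<bar> / lam 0 \<le> 0" using assms(2) by (simp add: Lambda_sum_def ennreal_eq_0_iff)
  then show ?thesis using assms(1) by (simp add: divide_le_0_iff)
qed

lemma Metric_space_Lambda_BV:
  assumes "Lambda_seq lam"
  shows "Metric_space (Lambda_BV lam) (Lambda_dist lam)"
proof
  have pos: "\<And>k. 0 < lam k" using assms by (auto simp: Lambda_seq_def)
  show "0 \<le> Lambda_dist lam f g" for f g by (simp add: Lambda_dist_def Lambda_norm_def)
  show "Lambda_dist lam f g = Lambda_dist lam g f" for f g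
    using Lambda_var_uminus[of lam "\<lambda>x. f x - g x"]
    by (simp add: Lambda_dist_def Lambda_norm_def abs_minus_commute)
  have fin: "Lambda_var lam (\<lambda>x. f x - g x) < \<infinity>"
    if "f \<in> Lambda_BV lam" "g \<in> Lambda_BV lam" for f g
    using that Lambda_var_diff_finite[of lam f g, OF pos] by (simp add: Lambda_BV_def)
  show "Lambda_dist lam f g = 0 \<longleftrightarrow> f = g" if "f \<in> Lambda_BV lam" "g \<in> Lambda_BV lam" for f g
  proof
    assume "Lambda_dist lam f g = 0"
    then have "enn2real (Lambda_var lam (\<lambda>x. f x - g x)) = 0" and z: "f 0 = g 0"
      unfolding Lambda_dist_def Lambda_norm_def
      by (smt (verit) enn2real_nonneg abs_ge_zero)+
    then have v: "Lambda_var lam (\<lambda>x. f x - g x) = 0"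
      using fin[OF that] by (auto simp: enn2real_eq_0_iff)
    have "f x = g x" if "x \<in> {0..1}" for x
      using Lambda_var_zero[OF pos v that] z by simp
    then show "f = g" using that by (auto simp: Lambda_BV_def intro: extensionalityI)
  next
    assume "f = g"
    moreover have "Lambda_var lam (\<lambda>x. 0) \<le> 0"
      unfolding Lambda_var_def by (rule SUP_least) (simp add: Lambda_sum_def)
    ultimately show "Lambda_dist lam f g = 0"
      by (simp add: Lambda_dist_def Lambda_norm_def)
  qed
  show "Lambda_dist lam f h \<le> Lambda_dist lam f g + Lambda_dist lam g h"
    if "f \<in> Lambda_BV lam" "g \<in> Lambda_BV lam" "h \<in> Lambda_BV lam" for f g h
  proof -
    have *: "Lambda_var lam (\<lambda>x. f x - h x)
        \<le> Lambda_var lam (\<lambda>x. f x - g x) + Lambda_var lam (\<lambda>x. g x - h x)"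
      using Lambda_var_triangle[of lam "\<lambda>x. f x - g x" "\<lambda>x. g x - h x", OF pos] by simp
    have "enn2real (Lambda_var lam (\<lambda>x. f x - h x))
        \<le> enn2real (Lambda_var lam (\<lambda>x. f x - g x) + Lambda_var lam (\<lambda>x. g x - h x))"
      using * fin that by (intro enn2real_mono) (auto simp: ennreal_add_less_top)
    also have "\<dots> = enn2real (Lambda_var lam (\<lambda>x. f x - g x)) + enn2real (Lambda_var lam (\<lambda>x. g x - h x))"
      using fin that by (intro enn2real_plus) auto
    finally show ?thesis unfolding Lambda_dist_def Lambda_norm_def by linarith
  qed
qed

lemma nonoverlapping_sum_length_le:
  assumes "nonoverlapping I"
  shows "(\<Sum>k < length I. snd (I ! k) - fst (I ! k)) \<le> 1"
proof -
  define S where "S = (\<lambda>k. {fst (I ! k)..snd (I ! k)})"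
  have ab: "0 \<le> fst (I ! k)" "fst (I ! k) \<le> snd (I ! k)" "snd (I ! k) \<le> 1" if "k < length I" for k
    using nonoverlapping_nth[OF assms that] by auto
  have neg: "negligible (S i \<inter> S j)" if "i < length I" "j < length I" "i \<noteq> j" for i j
  proof -
    have "S i \<inter> S j \<subseteq> {fst (I ! i), snd (I ! i)}"
      using assms that unfolding nonoverlapping_def S_def by blast
    then show ?thesis by (meson finite.intros finite_subset negligible_finite)
  qed
  have m: "measure lebesgue (S k) = snd (I ! k) - fst (I ! k)" if "k < length I" for k
    using ab[OF that] by (simp add: S_def)
  have "measure lebesgue (\<Union>k<length I. S k) = (\<Sum>k<length I. measure lebesgue (S k))"
    by (rule measure_negligible_finite_Union_image)
       (use neg in \<open>auto simp: pairwise_def S_def simp del: Int_atLeastAtMost\<close>)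
  moreover have "measure lebesgue (\<Union>k<length I. S k) \<le> measure lebesgue {0..1::real}"
    by (rule measure_mono_fmeasurable)
       (use ab in \<open>force simp: S_def intro!: sets.finite_UN\<close>)+
  ultimately show ?thesis using m by simp
qed

text \<open>
  Bernstein polynomials have finite variation, so the norms of the errors \<open>B\<^sub>n f - f\<close> are finite for
  \<open>f\<close> of finite variation.
\<close>

lemma bernstein_poly_in_Lambda_BV:
  assumes "Lambda_seq lam"
  shows "bernstein_poly n f \<in> Lambda_BV lam"
proof -
  define p where "p = (\<lambda>x. \<Sum>k\<le>n. f (real k / real n) * Bernstein n k x)"
  have pos: "\<And>k. 0 < lam k" and inc: "incseq lam" using assms by (auto simp: Lambda_seq_def)
  have "polynomial_function p"
    unfolding p_def Bernstein_def
    unfolding real_polynomial_function_eq[symmetric]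
    by (intro real_polynomial_function_sum real_polynomial_function.intros(4)
          real_polynomial_function_power real_polynomial_function_diff)
       (auto simp: real_polynomial_function_eq)
  then obtain p' where p': "polynomial_function p'" "\<And>x. (p has_vector_derivative p' x) (at x)"
    using has_vector_derivative_polynomial_function by blast
  have "bounded (p' ` {0..1})"
    by (intro compact_imp_bounded compact_continuous_image continuous_on_polymonial_function p') auto
  then obtain L where L: "\<And>x. x \<in> {0..1} \<Longrightarrow> \<bar>p' x\<bar> \<le> L" "0 < L"
    unfolding bounded_pos by (metis imageI real_norm_def)
  have lip: "\<bar>p b - p a\<bar> \<le> L * (b - a)" if "0 \<le> a" "a \<le> b" "b \<le> 1" for a b
  proof -
    have "norm (p b - p a) \<le> L * norm (b - a)"
    proof (rule field_differentiable_bound)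
      show "convex {0..1::real}" by simp
      show "(p has_field_derivative p' x) (at x within {0..1})" for x
        using p'(2)[of x] has_field_derivative_at_within
        by (auto simp: has_real_derivative_iff_has_vector_derivative[symmetric])
      show "norm (p' x) \<le> L" if "x \<in> {0..1}" for x using L(1)[OF that] by simp
    qed (use that in auto)
    then show ?thesis using that by simp
  qed
  have "Lambda_sum lam (bernstein_poly n f) I \<le> L / lam 0" if I: "nonoverlapping I" for I
  proof -
    have "Lambda_sum lam (bernstein_poly n f) I
        \<le> (\<Sum>k<length I. L * (snd (I ! k) - fst (I ! k)) / lam 0)"
      unfolding Lambda_sum_def
    proof (intro sum_mono)
      fix k assume "k \<in> {..<length I}"
      then have k: "0 \<le> fst (I ! k)" "fst (I ! k) \<le> snd (I ! k)" "snd (I ! k) \<le> 1"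
        using nonoverlapping_nth[OF I] by auto
      have "\<bar>bernstein_poly n f (snd (I ! k)) - bernstein_poly n f (fst (I ! k))\<bar>
          \<le> L * (snd (I ! k) - fst (I ! k))"
        using lip[OF k] k by (simp add: bernstein_poly_def p_def)
      then show "\<bar>bernstein_poly n f (snd (I ! k)) - bernstein_poly n f (fst (I ! k))\<bar> / lam k
          \<le> L * (snd (I ! k) - fst (I ! k)) / lam 0"
        using pos incseqD[OF inc, of 0 k] by (intro frac_le) (use k L(2) in auto)
    qed
    also have "\<dots> = L / lam 0 * (\<Sum>k<length I. snd (I ! k) - fst (I ! k))"
      by (simp add: sum_distrib_left)
    also have "\<dots> \<le> L / lam 0 * 1"
      using nonoverlapping_sum_length_le[OF I] L(2) pos[of 0] by (intro mult_left_mono) auto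
    finally show ?thesis by simp
  qed
  then have "Lambda_var lam (bernstein_poly n f) \<le> ennreal (L / lam 0)"
    unfolding Lambda_var_def by (intro SUP_least ennreal_leI) auto
  then have "Lambda_var lam (bernstein_poly n f) < \<infinity>" by (simp add: le_less_trans)
  then show ?thesis by (simp add: Lambda_BV_def bernstein_poly_def)
qed

end

theory Submission
  imports Defs
begin

text \<open>
  The heart of the matter is that a Bernstein polynomial has at most the variation of the function:
  \<open>V(B\<^sub>n f) \<le> V(f)\<close> for every sequence of weights (\<open>Lambda_var_bernstein_poly_le\<close>). This follows by
  coupling. If \<open>S(x)\<close> counts those of \<open>n\<close> independent uniform random points of \<open>{0..1}\<close> that are at
  most \<open>x\<close>, then \<open>B\<^sub>n f(x)\<close> is the expectation of \<open>f(S(x)/n)\<close>. As \<open>S\<close> is nondecreasing, it maps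
  nonoverlapping intervals to nonoverlapping intervals with endpoints in the grid \<open>{0, 1/n, \<dots>, 1}\<close>.
  So a variation sum of \<open>B\<^sub>n f\<close> is at most an average of variation sums of \<open>f\<close> over the grid.

  This bound has three uses.

  First, the operators \<open>B\<^sub>n\<close> are contractions in the norm.

  Secondly, \<open>B\<^sub>n f\<close> tends to \<open>f\<close> in norm if \<open>f\<close> is continuous and continuous in variation
  (\<open>bernstein_poly_tendsto_Lambda_dist\<close>): the first \<open>m\<close> terms of a variation sum of \<open>B\<^sub>n f - f\<close> are
  controlled by uniform convergence, and the other terms by the variation of \<open>f\<close> for the shifted
  weights, because the bound holds for these weights too. With contractivity, the convergence is
  uniform on a totally bounded set.

  Thirdly, since only grid values enter, functions with close values at the \<open>n + 1\<close> nodes have close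
  Bernstein polynomials. In a bounded set of functions the vectors of these values are bounded. So if
  \<open>B\<^sub>n f\<close> is close to \<open>f\<close> for all \<open>f\<close> in the set, then the set is covered by finitely many
  small balls (\<open>mtotally_bounded_if_bernstein_uniform\<close>).

  The space is complete (\<open>mcomplete_Lambda_BV\<close>), so its compact sets are the closed and totally
  bounded ones.
\<close>

section \<open>Nonoverlapping intervals and the variation\<close>

text \<open>
  In this form the condition passes through monotone maps, which can collapse intervals to points:
  only weak inequalities between endpoints are involved.
\<close>

lemma nonoverlapping_iff_ordered:
  "nonoverlapping I \<longleftrightarrow>
     (\<forall>k < length I. 0 \<le> fst (I ! k) \<and> fst (I ! k) \<le> snd (I ! k) \<and> snd (I ! k) \<le> 1) \<and>
     (\<forall>i < length I. \<forall>j < length I. i \<noteq> j \<longrightarrow>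
        snd (I ! i) \<le> fst (I ! j) \<or> snd (I ! j) \<le> fst (I ! i))"
  (is "_ \<longleftrightarrow> ?range \<and> ?ord")
proof (intro iffI conjI)
  assume I: "nonoverlapping I"
  show ?range using nonoverlapping_nth[OF I] by blast
  show ?ord
  proof (intro allI impI)
    fix i j assume ij: "i < length I" "j < length I" "i \<noteq> j"
    obtain a b where ab: "I ! i = (a, b)" by fastforce
    obtain c d where cd: "I ! j = (c, d)" by fastforce
    have le: "a \<le> b" "c \<le> d"
      using nonoverlapping_nth[OF I ij(1)] nonoverlapping_nth[OF I ij(2)] ab cd by auto
    \<comment> \<open>the midpoint of the intersection: two intervals that are not ordered meet in it, and it is
      not an endpoint of both\<close>
    define p where "p = (max a c + min b d) / 2"
    have "b \<le> c \<or> d \<le> a"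
    proof (rule ccontr)
      assume neg: "\<not> (b \<le> c \<or> d \<le> a)"
      then have "p \<in> {fst (I ! i)..snd (I ! i)} \<inter> {fst (I ! j)..snd (I ! j)}"
        using le unfolding ab cd p_def max_def min_def by simp
      moreover have "{fst (I ! i)..snd (I ! i)} \<inter> {fst (I ! j)..snd (I ! j)}
          \<subseteq> {fst (I ! i), snd (I ! i)} \<inter> {fst (I ! j), snd (I ! j)}"
        using I ij unfolding nonoverlapping_def by blast
      ultimately have "p \<in> {fst (I ! i), snd (I ! i)} \<inter> {fst (I ! j), snd (I ! j)}" by blast
      then have "p = a \<or> p = b" "p = c \<or> p = d" by (auto simp: ab cd)
      then show False using neg le unfolding p_def max_def min_def by (auto split: if_splits)
    qed
    then show "snd (I ! i) \<le> fst (I ! j) \<or> snd (I ! j) \<le> fst (I ! i)" using ab cd by simp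
  qed
next
  assume *: "?range \<and> ?ord"
  show "nonoverlapping I"
    unfolding nonoverlapping_def
  proof (intro conjI allI impI)
    have "0 \<le> fst p \<and> fst p \<le> snd p \<and> snd p \<le> 1" if "p \<in> set I" for p
      using * that by (metis in_set_conv_nth)
    then show "\<forall>(a, b) \<in> set I. 0 \<le> a \<and> a \<le> b \<and> b \<le> 1" by fastforce
    fix i j assume ij: "i < length I" "j < length I" "i \<noteq> j"
    have le: "fst (I ! i) \<le> snd (I ! i)" "fst (I ! j) \<le> snd (I ! j)" using * ij by blast+
    have "snd (I ! i) \<le> fst (I ! j) \<or> snd (I ! j) \<le> fst (I ! i)" using * ij by blast
    then show "{fst (I ! i)..snd (I ! i)} \<inter> {fst (I ! j)..snd (I ! j)}
        \<subseteq> {fst (I ! i), snd (I ! i)} \<inter> {fst (I ! j), snd (I ! j)}"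
      using le by auto
  qed
qed

lemma nonoverlapping_drop:
  assumes "nonoverlapping I"
  shows "nonoverlapping (drop m I)"
  using assms unfolding nonoverlapping_iff_ordered by auto

lemma nonoverlapping_mono_image:
  assumes I: "nonoverlapping I" and mono: "mono_on {0..1} h" and h: "h ` {0..1} \<subseteq> {0..1}"
  shows "nonoverlapping (map (map_prod h h) I)"
proof -
  note ab = nonoverlapping_nth[OF I]
  have mono': "h x \<le> h y" if "0 \<le> x" "x \<le> y" "y \<le> 1" for x y
    using that by (intro mono_onD[OF mono]) auto
  have rng: "0 \<le> h x" "h x \<le> 1" if "0 \<le> x" "x \<le> 1" for x
    using h that by (auto simp: image_subset_iff)
  show ?thesis
    unfolding nonoverlapping_iff_ordered
  proof (intro conjI allI impI)
    fix i j assume ij: "i < length (map (map_prod h h) I)" "j < length (map (map_prod h h) I)" "i \<noteq> j"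
    then have "snd (I ! i) \<le> fst (I ! j) \<or> snd (I ! j) \<le> fst (I ! i)"
      using I unfolding nonoverlapping_iff_ordered by simp
    then show "snd (map (map_prod h h) I ! i) \<le> fst (map (map_prod h h) I ! j) \<or>
        snd (map (map_prod h h) I ! j) \<le> fst (map (map_prod h h) I ! i)"
      using ij ab[of i] ab[of j] by (auto intro: mono')
  qed (use ab in \<open>auto intro!: mono' rng intro: order_trans\<close>)
qed

lemma Lambda_seq_pos: "Lambda_seq lam \<Longrightarrow> 0 < lam k"
  by (simp add: Lambda_seq_def)

lemma Lambda_seq_ge_first: "Lambda_seq lam \<Longrightarrow> lam 0 \<le> lam k"
  by (simp add: Lambda_seq_def incseqD)

lemma Lambda_seq_shift: "Lambda_seq lam \<Longrightarrow> Lambda_seq (shift_seq m lam)"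
  unfolding Lambda_seq_def shift_seq_def
  using summable_iff_shift[of "\<lambda>k. 1 / lam k" m] by (auto simp: incseq_def)

lemma Lambda_var_leI:
  "(\<And>I. nonoverlapping I \<Longrightarrow> Lambda_sum lam f I \<le> V) \<Longrightarrow> Lambda_var lam f \<le> ennreal V"
  unfolding Lambda_var_def by (intro SUP_least ennreal_leI) auto

lemma Lambda_sum_le_var:
  assumes "Lambda_var lam f < \<infinity>" "nonoverlapping I"
  shows "Lambda_sum lam f I \<le> enn2real (Lambda_var lam f)"
proof -
  have "ennreal (Lambda_sum lam f I) \<le> Lambda_var lam f"
    unfolding Lambda_var_def by (rule SUP_upper) (use assms in simp)
  also have "\<dots> = ennreal (enn2real (Lambda_var lam f))" using assms by simp
  finally show ?thesis by (subst (asm) ennreal_le_iff) auto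
qed

lemma Lambda_sum_cong:
  assumes "nonoverlapping I" "\<And>x. x \<in> {0..1} \<Longrightarrow> f x = g x"
  shows "Lambda_sum lam f I = Lambda_sum lam g I"
proof -
  have "f (fst (I ! k)) = g (fst (I ! k)) \<and> f (snd (I ! k)) = g (snd (I ! k))" if "k < length I" for k
    using nonoverlapping_nth[OF assms(1) that] assms(2) by auto
  then show ?thesis unfolding Lambda_sum_def by simp
qed

lemma Lambda_var_cong:
  assumes "\<And>x. x \<in> {0..1} \<Longrightarrow> f x = g x"
  shows "Lambda_var lam f = Lambda_var lam g"
  unfolding Lambda_var_def by (intro SUP_cong refl arg_cong[where f = ennreal] Lambda_sum_cong assms) auto

lemma abs_le_Lambda_norm:
  assumes lam: "Lambda_seq lam" and fin: "Lambda_var lam f < \<infinity>" and x: "x \<in> {0..1}"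
  shows "\<bar>f x\<bar> \<le> (1 + lam 0) * Lambda_norm lam f"
proof -
  have pos: "0 < lam 0" using lam by (rule Lambda_seq_pos)
  have "nonoverlapping [(0, x)]" using x by (auto simp: nonoverlapping_def)
  from Lambda_sum_le_var[OF fin this]
  have "\<bar>f x - f 0\<bar> \<le> lam 0 * enn2real (Lambda_var lam f)"
    using pos by (simp add: Lambda_sum_def field_simps)
  then have "\<bar>f x\<bar> \<le> lam 0 * enn2real (Lambda_var lam f) + \<bar>f 0\<bar>" by linarith
  also have "\<dots> \<le> (1 + lam 0) * Lambda_norm lam f"
    using pos by (simp add: Lambda_norm_def algebra_simps)
  finally show ?thesis .
qed

text \<open>
  The first \<open>m\<close> terms of a variation sum are bounded one by one through the supremum of \<open>\<bar>f\<bar>\<close>; the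
  remaining terms form a variation sum for the shifted weights.
\<close>

lemma Lambda_var_le_head_tail:
  assumes lam: "Lambda_seq lam" and bound: "\<And>x. x \<in> {0..1} \<Longrightarrow> \<bar>f x\<bar> \<le> \<eta>"
  shows "Lambda_var lam f \<le> ennreal (2 * real m * \<eta> / lam 0) + Lambda_var (shift_seq m lam) f"
  unfolding Lambda_var_def[of lam]
proof (rule SUP_least)
  fix I assume "I \<in> {I. nonoverlapping I}"
  then have I: "nonoverlapping I" by simp
  have pos: "0 < lam k" for k using lam by (rule Lambda_seq_pos)
  have \<eta>: "0 \<le> \<eta>" using bound[of 0] by simp
  define t where "t k = \<bar>f (snd (I ! k)) - f (fst (I ! k))\<bar> / lam k" for k
  have "Lambda_sum lam f I = sum t {..<length I}" by (simp add: Lambda_sum_def t_def)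
  also have "\<dots> \<le> sum t ({..<min m (length I)} \<union> (\<lambda>k. k + m) ` {..<length I - m})"
  proof (rule sum_mono2)
    show "{..<length I} \<subseteq> {..<min m (length I)} \<union> (\<lambda>k. k + m) ` {..<length I - m}"
    proof
      fix k assume "k \<in> {..<length I}"
      then show "k \<in> {..<min m (length I)} \<union> (\<lambda>k. k + m) ` {..<length I - m}"
        by (cases "k < m") (auto intro!: image_eqI[of _ _ "k - m"])
    qed
    show "0 \<le> t k" for k using pos[of k] by (simp add: t_def)
  qed simp
  also have "\<dots> = sum t {..<min m (length I)} + (\<Sum>k<length I - m. t (k + m))"
    by (subst sum.union_disjoint) (auto simp: sum.reindex)
  also have "sum t {..<min m (length I)} \<le> (\<Sum>k<min m (length I). 2 * \<eta> / lam 0)"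
  proof (rule sum_mono)
    fix k assume "k \<in> {..<min m (length I)}"
    then have "\<bar>f (snd (I ! k))\<bar> \<le> \<eta>" "\<bar>f (fst (I ! k))\<bar> \<le> \<eta>"
      using nonoverlapping_nth[OF I, of k] by (auto intro!: bound)
    then show "t k \<le> 2 * \<eta> / lam 0"
      unfolding t_def using pos[of 0] Lambda_seq_ge_first[OF lam, of k] by (intro frac_le) auto
  qed
  also have "(\<Sum>k<min m (length I). 2 * \<eta> / lam 0) = 2 * real (min m (length I)) * \<eta> / lam 0" by simp
  also have "\<dots> \<le> 2 * real m * \<eta> / lam 0"
    using \<eta> pos[of 0] by (intro divide_right_mono mult_right_mono) auto
  also have "(\<Sum>k<length I - m. t (k + m)) = Lambda_sum (shift_seq m lam) f (drop m I)"
    by (auto simp: Lambda_sum_def t_def shift_seq_def add.commute intro!: sum.cong)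
  finally have "ennreal (Lambda_sum lam f I)
      \<le> ennreal (2 * real m * \<eta> / lam 0 + Lambda_sum (shift_seq m lam) f (drop m I))"
    by (intro ennreal_leI) simp
  also have "\<dots> \<le> ennreal (2 * real m * \<eta> / lam 0) + ennreal (Lambda_sum (shift_seq m lam) f (drop m I))"
    using \<eta> pos by (subst ennreal_plus) (auto simp: Lambda_sum_def shift_seq_def less_imp_le intro!: sum_nonneg divide_nonneg_pos)
  also have "ennreal (Lambda_sum (shift_seq m lam) f (drop m I)) \<le> Lambda_var (shift_seq m lam) f"
    unfolding Lambda_var_def by (rule SUP_upper) (use nonoverlapping_drop[OF I] in simp)
  finally show "ennreal (Lambda_sum lam f I)
      \<le> ennreal (2 * real m * \<eta> / lam 0) + Lambda_var (shift_seq m lam) f" by simp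
qed

section \<open>Bernstein polynomials do not increase the variation\<close>

text \<open>
  Conditioning a binomial variable on its first trial, which succeeds with probability \<open>x\<close>.
\<close>

lemma Bernstein_average_Suc:
  "(\<Sum>j\<le>Suc n. g j * Bernstein (Suc n) j x) =
     x * (\<Sum>j\<le>n. g (Suc j) * Bernstein n j x) + (1 - x) * (\<Sum>j\<le>n. g j * Bernstein n j x)"
proof -
  have Suc: "Bernstein (Suc n) (Suc j) x
      = x * Bernstein n j x + (1 - x) * Bernstein n (Suc j) x" for j
  proof (cases "j < n")
    case True
    then have "n - j = Suc (n - Suc j)" by simp
    then show ?thesis by (simp add: Bernstein_def algebra_simps)
  next
    case False
    then show ?thesis by (simp add: Bernstein_def binomial_eq_0)
  qed
  have "(\<Sum>j\<le>Suc n. g j * Bernstein (Suc n) j x)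
      = g 0 * Bernstein (Suc n) 0 x + (\<Sum>j\<le>n. g (Suc j) * Bernstein (Suc n) (Suc j) x)"
    by (rule sum.atMost_Suc_shift)
  also have "(\<Sum>j\<le>n. g (Suc j) * Bernstein (Suc n) (Suc j) x)
      = x * (\<Sum>j\<le>n. g (Suc j) * Bernstein n j x)
        + (1 - x) * (\<Sum>j\<le>n. g (Suc j) * Bernstein n (Suc j) x)"
    unfolding sum_distrib_left sum.distrib[symmetric]
    by (intro sum.cong refl) (simp only: Suc distrib_left mult_ac)
  also have "Bernstein (Suc n) 0 x = (1 - x) * Bernstein n 0 x" by (simp add: Bernstein_def)
  also have "g 0 * ((1 - x) * Bernstein n 0 x) + (x * (\<Sum>j\<le>n. g (Suc j) * Bernstein n j x)
        + (1 - x) * (\<Sum>j\<le>n. g (Suc j) * Bernstein n (Suc j) x))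
      = x * (\<Sum>j\<le>n. g (Suc j) * Bernstein n j x)
        + (1 - x) * (g 0 * Bernstein n 0 x + (\<Sum>j\<le>n. g (Suc j) * Bernstein n (Suc j) x))"
    by (simp only: distrib_left mult_ac add_ac)
  also have "g 0 * Bernstein n 0 x + (\<Sum>j\<le>n. g (Suc j) * Bernstein n (Suc j) x)
      = (\<Sum>j\<le>Suc n. g j * Bernstein n j x)"
    by (rule sum.atMost_Suc_shift[symmetric])
  also have "\<dots> = (\<Sum>j\<le>n. g j * Bernstein n j x)"
    by (simp add: Bernstein_def)
  finally show ?thesis .
qed

text \<open>
  The coupling argument, with the \<open>n\<close> random points placed one at a time. The average over the
  first point \<open>u\<close> is an integral over \<open>{0..1}\<close>, and the point adds its own counting function
  \<open>x \<mapsto> (if u \<le> x then 1 else 0)\<close> to \<open>c\<close>. The nondecreasing function \<open>c\<close> counts the points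
  placed so far; it is arbitrary in the induction because it absorbs each new point.
\<close>

lemma Bernstein_average_increments_le:
  fixes g :: "nat \<Rightarrow> real" and c :: "real \<Rightarrow> nat" and m :: nat
  assumes bound: "\<And>d. mono_on {0..1} d \<Longrightarrow> (\<And>x. x \<in> {0..1} \<Longrightarrow> d x \<le> N) \<Longrightarrow>
      (\<Sum>k<m. w k * \<bar>g (d (b k)) - g (d (a k))\<bar>) \<le> M"
    and w: "\<And>k. k < m \<Longrightarrow> 0 \<le> w k"
    and ab: "\<And>k. k < m \<Longrightarrow> a k \<in> {0..1} \<and> b k \<in> {0..1}"
    and c: "mono_on {0..1} c" "\<And>x. x \<in> {0..1} \<Longrightarrow> c x + n \<le> N"
  shows "(\<Sum>k<m. w k * \<bar>(\<Sum>j\<le>n. g (c (b k) + j) * Bernstein n j (b k))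
      - (\<Sum>j\<le>n. g (c (a k) + j) * Bernstein n j (a k))\<bar>) \<le> M"
  using c
proof (induction n arbitrary: c)
  case 0
  then show ?case using bound[of c] by (simp add: Bernstein_def)
next
  case (Suc n)
  define A where "A n c x = (\<Sum>j\<le>n. g (c x + j) * Bernstein n j x)" for n and c :: "real \<Rightarrow> nat" and x
  define cu where "cu u x = c x + (if u \<le> x then 1 else 0)" for u x
  have A_int: "((\<lambda>u. A n (cu u) x) has_integral A (Suc n) c x) {0..1}" if "x \<in> {0..1}" for x
  proof -
    define r where "r = A n (\<lambda>x. Suc (c x)) x - A n c x"
    have "((\<lambda>u. r) has_integral x * r) {0..x}"
      using has_integral_const_real[of r 0 x] that by simp
    then have "((\<lambda>u. if u \<in> {0..x} then r else 0) has_integral x * r) {0..1}"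
      using that by (subst has_integral_restrict) auto
    then have "((\<lambda>u. A n c x + (if u \<in> {0..x} then r else 0)) has_integral A n c x + x * r) {0..1}"
      using has_integral_add[OF has_integral_const_real[of "A n c x" 0 1]] by simp
    moreover have "A n c x + x * r = A (Suc n) c x"
      unfolding A_def r_def Bernstein_average_Suc by (simp add: algebra_simps)
    moreover have "A n c x + (if u \<in> {0..x} then r else 0) = A n (cu u) x" if "u \<in> {0..1}" for u
      using that by (simp add: A_def cu_def r_def)
    ultimately show ?thesis
      using has_integral_eq[of "{0..1}" "\<lambda>u. A n c x + (if u \<in> {0..x} then r else 0)"
          "\<lambda>u. A n (cu u) x" "A n c x + x * r"] by simp
  qed
  \<comment> \<open>the signs turn the sum of absolute values into a linear expression, so that it becomes the
    integral of an expression to which the induction hypothesis applies for each \<open>u\<close>\<close>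
  define s where "s k = w k * sgn (A (Suc n) c (b k) - A (Suc n) c (a k))" for k
  have "((\<lambda>u. \<Sum>k<m. s k * (A n (cu u) (b k) - A n (cu u) (a k)))
      has_integral (\<Sum>k<m. s k * (A (Suc n) c (b k) - A (Suc n) c (a k)))) {0..1}"
    using ab by (intro has_integral_sum has_integral_mult_right has_integral_diff A_int) auto
  moreover have "(\<Sum>k<m. s k * (A n (cu u) (b k) - A n (cu u) (a k))) \<le> M" for u
  proof -
    have "(\<Sum>k<m. s k * (A n (cu u) (b k) - A n (cu u) (a k)))
        \<le> (\<Sum>k<m. w k * \<bar>A n (cu u) (b k) - A n (cu u) (a k)\<bar>)"
    proof (rule sum_mono)
      fix k assume "k \<in> {..<m}"
      then have "0 \<le> w k" by (intro w) simp
      then have "w k * (sgn z * y) \<le> w k * \<bar>y\<bar>" for z y :: real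
        by (intro mult_left_mono) (auto simp: sgn_if)
      then show "s k * (A n (cu u) (b k) - A n (cu u) (a k))
          \<le> w k * \<bar>A n (cu u) (b k) - A n (cu u) (a k)\<bar>"
        by (simp add: s_def mult.assoc)
    qed
    also have "\<dots> \<le> M"
      unfolding A_def
    proof (rule Suc.IH)
      show "mono_on {0..1} (cu u)"
      proof (rule mono_onI)
        fix x y :: real assume "x \<in> {0..1}" "y \<in> {0..1}" "x \<le> y"
        then have "c x \<le> c y" by (rule mono_onD[OF Suc.prems(1)])
        then show "cu u x \<le> cu u y" using \<open>x \<le> y\<close> by (simp add: cu_def)
      qed
      show "cu u x + n \<le> N" if "x \<in> {0..1}" for x
        using Suc.prems(2)[OF that] by (simp add: cu_def)
    qed
    finally show ?thesis .
  qed
  ultimately have "(\<Sum>k<m. s k * (A (Suc n) c (b k) - A (Suc n) c (a k))) \<le> M"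
    using has_integral_le[OF _ has_integral_const_real[of M 0 1]] by simp
  moreover have "s k * (A (Suc n) c (b k) - A (Suc n) c (a k))
      = w k * \<bar>A (Suc n) c (b k) - A (Suc n) c (a k)\<bar>" for k
    by (simp add: s_def abs_sgn mult_ac)
  ultimately show ?case unfolding A_def by simp
qed

text \<open>
  The endpoints of the intervals in \<open>J\<close> are kept on the grid because this gives, besides the bound by
  the variation of \<open>f\<close>, one that depends only on the values of \<open>f\<close> at the nodes.
\<close>

lemma Lambda_sum_bernstein_poly_le:
  assumes lam: "Lambda_seq lam" and n: "0 < n" and I: "nonoverlapping I"
    and bound: "\<And>J. nonoverlapping J \<Longrightarrow>
      (\<And>k. k < length J \<Longrightarrow> \<exists>i\<le>n. \<exists>j\<le>n. J ! k = (real i / real n, real j / real n)) \<Longrightarrow>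
      Lambda_sum lam f J \<le> M"
  shows "Lambda_sum lam (bernstein_poly n f) I \<le> M"
proof -
  define a where "a k = fst (I ! k)" for k
  define b where "b k = snd (I ! k)" for k
  define g where "g j = f (real j / real n)" for j
  have ab: "a k \<in> {0..1} \<and> b k \<in> {0..1}" if "k < length I" for k
    using nonoverlapping_nth[OF I that] by (auto simp: a_def b_def)
  have "(\<Sum>k<length I. 1 / lam k * \<bar>(\<Sum>j\<le>n. g (0 + j) * Bernstein n j (b k))
      - (\<Sum>j\<le>n. g (0 + j) * Bernstein n j (a k))\<bar>) \<le> M"
  proof (rule Bernstein_average_increments_le[where N = n and c = "\<lambda>x. 0"])
    fix d :: "real \<Rightarrow> nat"
    assume d: "mono_on {0..1} d" "\<And>x. x \<in> {0..1} \<Longrightarrow> d x \<le> n"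
    define h where "h x = real (d x) / real n" for x
    have "nonoverlapping (map (map_prod h h) I)"
    proof (rule nonoverlapping_mono_image[OF I])
      show "mono_on {0..1} h"
        using d(1) by (auto simp: mono_on_def h_def intro!: divide_right_mono)
      show "h ` {0..1} \<subseteq> {0..1}" using d(2) n by (auto simp: h_def divide_le_eq)
    qed
    moreover have "\<exists>i\<le>n. \<exists>j\<le>n. map (map_prod h h) I ! k = (real i / real n, real j / real n)"
      if "k < length (map (map_prod h h) I)" for k
    proof -
      have "map (map_prod h h) I ! k = (real (d (a k)) / real n, real (d (b k)) / real n)"
        using that by (simp add: a_def b_def h_def map_prod_def split_beta)
      then show ?thesis using ab[of k] d(2) that by auto
    qed
    ultimately have "Lambda_sum lam f (map (map_prod h h) I) \<le> M" by (rule bound)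
    moreover have "Lambda_sum lam f (map (map_prod h h) I)
        = (\<Sum>k<length I. 1 / lam k * \<bar>g (d (b k)) - g (d (a k))\<bar>)"
      unfolding Lambda_sum_def by (auto simp: g_def h_def a_def b_def intro!: sum.cong)
    ultimately show "(\<Sum>k<length I. 1 / lam k * \<bar>g (d (b k)) - g (d (a k))\<bar>) \<le> M" by simp
  qed (use ab in \<open>auto simp: mono_on_def less_imp_le Lambda_seq_pos[OF lam]\<close>)
  moreover have "Lambda_sum lam (bernstein_poly n f) I
      = (\<Sum>k<length I. 1 / lam k * \<bar>(\<Sum>j\<le>n. g (0 + j) * Bernstein n j (b k))
      - (\<Sum>j\<le>n. g (0 + j) * Bernstein n j (a k))\<bar>)"
    unfolding Lambda_sum_def
  proof (rule sum.cong[OF refl])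
    fix k assume "k \<in> {..<length I}"
    then have "a k \<in> {0..1}" "b k \<in> {0..1}" using ab by auto
    then show "\<bar>bernstein_poly n f (snd (I ! k)) - bernstein_poly n f (fst (I ! k))\<bar> / lam k
        = 1 / lam k * \<bar>(\<Sum>j\<le>n. g (0 + j) * Bernstein n j (b k))
          - (\<Sum>j\<le>n. g (0 + j) * Bernstein n j (a k))\<bar>"
      unfolding a_def[symmetric] b_def[symmetric] by (simp add: bernstein_poly_def g_def)
  qed
  ultimately show ?thesis by simp
qed

lemma Lambda_var_bernstein_poly_le:
  assumes "Lambda_seq lam" "0 < n"
  shows "Lambda_var lam (bernstein_poly n f) \<le> Lambda_var lam f"
proof (cases "Lambda_var lam f < \<infinity>")
  case True
  have "Lambda_var lam (bernstein_poly n f) \<le> ennreal (enn2real (Lambda_var lam f))"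
    using Lambda_sum_le_var[OF True] by (intro Lambda_var_leI Lambda_sum_bernstein_poly_le assms) auto
  then show ?thesis using True by simp
next
  case False
  then show ?thesis by (simp add: not_less top_unique)
qed

text \<open>
  Nonoverlapping intervals with endpoints in the grid have total length at most 1, and each
  nondegenerate one has length at least \<open>1/n\<close>; so at most \<open>n\<close> increments, each at most \<open>2 * \<delta>\<close>,
  contribute.
\<close>

lemma Lambda_var_bernstein_poly_le_nodes:
  assumes lam: "Lambda_seq lam" and n: "0 < n" and f: "\<And>k. k \<le> n \<Longrightarrow> \<bar>f (real k / real n)\<bar> \<le> \<delta>"
  shows "Lambda_var lam (bernstein_poly n f) \<le> ennreal (2 * real n * \<delta> / lam 0)"
proof (rule Lambda_var_leI, rule Lambda_sum_bernstein_poly_le[OF lam n], assumption)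
  fix J
  assume J: "nonoverlapping J"
    and grid: "\<And>k. k < length J \<Longrightarrow> \<exists>i\<le>n. \<exists>j\<le>n. J ! k = (real i / real n, real j / real n)"
  have \<delta>: "0 \<le> \<delta>" using f[of 0] by simp
  have pos: "0 < lam 0" using lam by (rule Lambda_seq_pos)
  have "Lambda_sum lam f J \<le> (\<Sum>k<length J. 2 * real n * \<delta> / lam 0 * (snd (J ! k) - fst (J ! k)))"
    unfolding Lambda_sum_def
  proof (rule sum_mono)
    fix k assume "k \<in> {..<length J}"
    then have k: "k < length J" by simp
    obtain i j where ij: "i \<le> n" "j \<le> n" "J ! k = (real i / real n, real j / real n)"
      using grid[OF k] by blast
    have "i \<le> j" using nonoverlapping_nth(2)[OF J k] n by (simp add: ij(3) divide_le_cancel)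
    have "\<bar>f (real j / real n) - f (real i / real n)\<bar> \<le> 2 * \<delta> * (real j - real i)"
    proof (cases "i = j")
      case False
      have "\<bar>f (real j / real n) - f (real i / real n)\<bar> \<le> 2 * \<delta> * 1"
        using f[OF ij(1)] f[OF ij(2)] by linarith
      also have "\<dots> \<le> 2 * \<delta> * (real j - real i)"
        using \<delta> \<open>i \<le> j\<close> False by (intro mult_left_mono) auto
      finally show ?thesis .
    qed simp
    then have "\<bar>f (real j / real n) - f (real i / real n)\<bar> / lam k \<le> 2 * \<delta> * (real j - real i) / lam 0"
      using pos \<delta> \<open>i \<le> j\<close> Lambda_seq_ge_first[OF lam, of k] by (intro frac_le) auto
    also have "\<dots> = 2 * real n * \<delta> / lam 0 * (real j / real n - real i / real n)"
      using n pos by (simp add: field_simps)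
    finally show "\<bar>f (snd (J ! k)) - f (fst (J ! k))\<bar> / lam k
        \<le> 2 * real n * \<delta> / lam 0 * (snd (J ! k) - fst (J ! k))"
      by (simp add: ij(3))
  qed
  also have "\<dots> = 2 * real n * \<delta> / lam 0 * (\<Sum>k<length J. snd (J ! k) - fst (J ! k))"
    by (simp add: sum_distrib_left)
  also have "\<dots> \<le> 2 * real n * \<delta> / lam 0 * 1"
    using nonoverlapping_sum_length_le[OF J] \<delta> pos by (intro mult_left_mono) auto
  finally show "Lambda_sum lam f J \<le> 2 * real n * \<delta> / lam 0" by simp
qed

lemma bernstein_poly_diff:
  "x \<in> {0..1} \<Longrightarrow>
    bernstein_poly n f x - bernstein_poly n g x = bernstein_poly n (\<lambda>x. f x - g x) x"
  by (simp add: bernstein_poly_def left_diff_distrib sum_subtractf)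

lemma bernstein_poly_at_0: "bernstein_poly n f 0 = f 0"
proof -
  have "f (real k / real n) * Bernstein n k 0 = (if k = 0 then f 0 else 0)" for k
    by (simp add: Bernstein_def power_0_left)
  then show ?thesis by (simp add: bernstein_poly_def)
qed

lemma Lambda_BV_diff_finite:
  assumes "Lambda_seq lam" "f \<in> Lambda_BV lam" "g \<in> Lambda_BV lam"
  shows "Lambda_var lam (\<lambda>x. f x - g x) < \<infinity>"
  using assms Lambda_var_diff_finite[of lam f g] by (simp add: Lambda_BV_def Lambda_seq_pos)

lemma Lambda_dist_bernstein_poly_le:
  assumes lam: "Lambda_seq lam" and n: "0 < n" and f: "f \<in> Lambda_BV lam" and g: "g \<in> Lambda_BV lam"
  shows "Lambda_dist lam (bernstein_poly n f) (bernstein_poly n g) \<le> Lambda_dist lam f g"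
proof -
  have "Lambda_var lam (\<lambda>x. bernstein_poly n f x - bernstein_poly n g x)
      = Lambda_var lam (bernstein_poly n (\<lambda>x. f x - g x))"
    by (intro Lambda_var_cong bernstein_poly_diff)
  also have "\<dots> \<le> Lambda_var lam (\<lambda>x. f x - g x)"
    by (intro Lambda_var_bernstein_poly_le lam n)
  finally show ?thesis
    using Lambda_BV_diff_finite[OF lam f g]
    by (simp add: Lambda_dist_def Lambda_norm_def bernstein_poly_at_0 enn2real_mono)
qed

lemma Lambda_dist_bernstein_poly_le_nodes:
  assumes lam: "Lambda_seq lam" and n: "0 < n"
    and fg: "\<And>k. k \<le> n \<Longrightarrow> \<bar>f (real k / real n) - g (real k / real n)\<bar> \<le> \<delta>"
  shows "Lambda_dist lam (bernstein_poly n f) (bernstein_poly n g) \<le> (2 * real n / lam 0 + 1) * \<delta>"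
proof -
  have "Lambda_var lam (\<lambda>x. bernstein_poly n f x - bernstein_poly n g x)
      = Lambda_var lam (bernstein_poly n (\<lambda>x. f x - g x))"
    by (intro Lambda_var_cong bernstein_poly_diff)
  also have "\<dots> \<le> ennreal (2 * real n * \<delta> / lam 0)"
    by (intro Lambda_var_bernstein_poly_le_nodes lam n fg)
  finally have "enn2real (Lambda_var lam (\<lambda>x. bernstein_poly n f x - bernstein_poly n g x))
      \<le> enn2real (ennreal (2 * real n * \<delta> / lam 0))"
    by (intro enn2real_mono) auto
  also have "\<dots> = 2 * real n * \<delta> / lam 0"
    using fg[of 0] Lambda_seq_pos[OF lam, of 0] by (intro enn2real_ennreal) auto
  finally show ?thesis
    using fg[of 0] by (simp add: Lambda_dist_def Lambda_norm_def bernstein_poly_at_0 algebra_simps)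
qed

section \<open>Convergence of Bernstein polynomials in the variation norm\<close>

text \<open>
  Choose \<open>m\<close> to make the variation of \<open>f\<close> for the weights shifted by \<open>m\<close> small; it bounds that of
  \<open>B\<^sub>n f\<close> for all \<open>n\<close> at once. With \<open>m\<close> fixed, the classical uniform convergence of \<open>B\<^sub>n f\<close> takes
  care of the first \<open>m\<close> terms.
\<close>

lemma bernstein_poly_tendsto_Lambda_dist:
  assumes lam: "Lambda_seq lam" and f: "f \<in> C_Lambda_BV_c lam"
  shows "(\<lambda>n. Lambda_dist lam (bernstein_poly n f) f) \<longlonglongrightarrow> 0"
proof (rule tendstoI)
  fix e :: real assume e: "0 < e"
  have cont: "continuous_on {0..1} f" and lim: "(\<lambda>m. Lambda_var (shift_seq m lam) f) \<longlonglongrightarrow> 0"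
    using f by (auto simp: C_Lambda_BV_c_def continuous_in_Lambda_var_def)
  have pos: "0 < lam 0" using lam by (rule Lambda_seq_pos)
  have "eventually (\<lambda>m. Lambda_var (shift_seq m lam) f < ennreal (e / 8)) sequentially"
    using e by (intro order_tendstoD(2)[OF lim]) simp
  then obtain m where m: "Lambda_var (shift_seq m lam) f < ennreal (e / 8)"
    by (auto simp: eventually_sequentially)
  \<comment> \<open>the uniform error enters the norm with the factor \<open>2 * m / lam 0\<close> from the first \<open>m\<close> terms
    and with the factor 1 from the value at 0\<close>
  define \<eta> where "\<eta> = e / 4 / (2 * real m / lam 0 + 1)"
  have den: "0 < 2 * real m / lam 0 + 1" using pos by (simp add: add_nonneg_pos)
  then have \<eta>: "0 < \<eta>" using e by (simp add: \<eta>_def)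
  obtain N where N: "\<And>n x. N \<le> n \<Longrightarrow> x \<in> {0..1} \<Longrightarrow>
      \<bar>f x - (\<Sum>k\<le>n. f (real k / real n) * Bernstein n k x)\<bar> < \<eta>"
    using Bernstein_Weierstrass[OF cont \<eta>] by blast
  show "\<forall>\<^sub>F n in sequentially. dist (Lambda_dist lam (bernstein_poly n f) f) 0 < e"
    unfolding eventually_sequentially
  proof (intro exI allI impI)
    fix n assume n: "max N 1 \<le> n"
    define h where "h x = bernstein_poly n f x - f x" for x
    have h: "\<bar>h x\<bar> \<le> \<eta>" if "x \<in> {0..1}" for x
      using N[of n x] n that by (simp add: h_def bernstein_poly_def)
    have "Lambda_var lam h \<le> ennreal (2 * real m * \<eta> / lam 0) + Lambda_var (shift_seq m lam) h"
      by (intro Lambda_var_le_head_tail lam h)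
    also have "Lambda_var (shift_seq m lam) h
        \<le> Lambda_var (shift_seq m lam) (bernstein_poly n f) + Lambda_var (shift_seq m lam) (\<lambda>x. - f x)"
      using Lambda_var_triangle[of "shift_seq m lam" "bernstein_poly n f" "\<lambda>x. - f x"]
        Lambda_seq_pos[OF Lambda_seq_shift[OF lam]]
      by (simp add: h_def[abs_def])
    also have "\<dots> \<le> Lambda_var (shift_seq m lam) f + Lambda_var (shift_seq m lam) f"
      unfolding Lambda_var_uminus using n
      by (intro add_mono Lambda_var_bernstein_poly_le Lambda_seq_shift lam) auto
    also have "\<dots> \<le> ennreal (e / 8) + ennreal (e / 8)" using m by (intro add_mono) auto
    also have "ennreal (2 * real m * \<eta> / lam 0) + (ennreal (e / 8) + ennreal (e / 8))
        = ennreal (2 * real m * \<eta> / lam 0 + e / 4)"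
      using e \<eta> pos by (subst ennreal_plus[symmetric] | simp)+
    finally have "enn2real (Lambda_var lam h) \<le> enn2real (ennreal (2 * real m * \<eta> / lam 0 + e / 4))"
      by (intro enn2real_mono) (auto simp: add_left_mono)
    also have "\<dots> = 2 * real m * \<eta> / lam 0 + e / 4"
      using e \<eta> pos by (intro enn2real_ennreal) auto
    finally have "Lambda_norm lam h \<le> (2 * real m / lam 0 + 1) * \<eta> + e / 4"
      using h[of 0] by (simp add: Lambda_norm_def algebra_simps)
    also have "(2 * real m / lam 0 + 1) * \<eta> = e / 4"
      using den unfolding \<eta>_def by (metis less_irrefl nonzero_mult_div_cancel_left times_divide_eq_right)
    finally have "Lambda_norm lam h < e" using e by simp
    then show "dist (Lambda_dist lam (bernstein_poly n f) f) 0 < e"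
      by (simp add: Lambda_dist_def h_def[abs_def] Lambda_norm_def)
  qed
qed

section \<open>Completeness and total boundedness\<close>

text \<open>
  The norm dominates point evaluations, so a Cauchy sequence converges pointwise. It converges in
  norm to its pointwise limit because each single variation sum is continuous under pointwise
  convergence.
\<close>

lemma mcomplete_Lambda_BV:
  assumes lam: "Lambda_seq lam"
  shows "Metric_space.mcomplete (Lambda_BV lam) (Lambda_dist lam)"
proof -
  interpret Metric_space "Lambda_BV lam" "Lambda_dist lam" by (rule Metric_space_Lambda_BV[OF lam])
  have pos: "0 < lam k" for k using lam by (rule Lambda_seq_pos)
  show ?thesis
    unfolding mcomplete_def
  proof (intro allI impI)
    fix \<sigma> assume "MCauchy \<sigma>"
    then have \<sigma>: "\<sigma> n \<in> Lambda_BV lam"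
      and C: "\<And>\<epsilon>. 0 < \<epsilon> \<Longrightarrow> \<exists>N. \<forall>n n'. N \<le> n \<longrightarrow> N \<le> n' \<longrightarrow> Lambda_dist lam (\<sigma> n) (\<sigma> n') < \<epsilon>" for n
      unfolding MCauchy_def by auto
    have fin: "Lambda_var lam (\<lambda>x. \<sigma> n x - \<sigma> n' x) < \<infinity>" for n n'
      by (intro Lambda_BV_diff_finite lam \<sigma>)
    have "convergent (\<lambda>n. \<sigma> n x)" if x: "x \<in> {0..1}" for x
      unfolding Cauchy_convergent_iff[symmetric]
    proof (rule CauchyI)
      fix e :: real assume e: "0 < e"
      have "0 < e / (1 + lam 0)" using e pos[of 0] by simp
      from C[OF this] obtain N where N: "\<And>n n'. N \<le> n \<Longrightarrow> N \<le> n' \<Longrightarrow>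
          Lambda_dist lam (\<sigma> n) (\<sigma> n') < e / (1 + lam 0)" by blast
      have "norm (\<sigma> n x - \<sigma> n' x) < e" if "N \<le> n" "N \<le> n'" for n n'
      proof -
        have "\<bar>\<sigma> n x - \<sigma> n' x\<bar> \<le> (1 + lam 0) * Lambda_dist lam (\<sigma> n) (\<sigma> n')"
          using abs_le_Lambda_norm[OF lam fin x] by (simp add: Lambda_dist_def)
        also have "\<dots> < e" using N[OF that] pos[of 0] by (simp add: field_simps)
        finally show ?thesis by simp
      qed
      then show "\<exists>N. \<forall>n\<ge>N. \<forall>n'\<ge>N. norm (\<sigma> n x - \<sigma> n' x) < e" by blast
    qed
    then obtain g where g: "\<And>x. x \<in> {0..1} \<Longrightarrow> (\<lambda>n. \<sigma> n x) \<longlonglongrightarrow> g x"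
      unfolding convergent_def by metis
    define f where "f = restrict g {0..1}"
    have f: "(\<lambda>n. \<sigma> n x) \<longlonglongrightarrow> f x" if "x \<in> {0..1}" for x using g[OF that] that by (simp add: f_def)
    have close: "\<exists>N. \<forall>n\<ge>N. Lambda_var lam (\<lambda>x. \<sigma> n x - f x) \<le> ennreal e \<and> \<bar>\<sigma> n 0 - f 0\<bar> \<le> e"
      if e: "0 < e" for e
    proof -
      obtain N where N: "\<And>n n'. N \<le> n \<Longrightarrow> N \<le> n' \<Longrightarrow> Lambda_dist lam (\<sigma> n) (\<sigma> n') < e"
        using C[OF e] by blast
      have var: "Lambda_sum lam (\<lambda>x. \<sigma> n x - f x) I \<le> e" if n: "N \<le> n" and I: "nonoverlapping I" for n I
      proof (rule tendsto_upperbound)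
        show "(\<lambda>n'. Lambda_sum lam (\<lambda>x. \<sigma> n x - \<sigma> n' x) I) \<longlonglongrightarrow> Lambda_sum lam (\<lambda>x. \<sigma> n x - f x) I"
          unfolding Lambda_sum_def
        proof (intro tendsto_sum)
          fix k assume "k \<in> {..<length I}"
          then have "fst (I ! k) \<in> {0..1}" "snd (I ! k) \<in> {0..1}"
            using nonoverlapping_nth[OF I, of k] by auto
          then show "(\<lambda>n'. \<bar>\<sigma> n (snd (I ! k)) - \<sigma> n' (snd (I ! k))
                - (\<sigma> n (fst (I ! k)) - \<sigma> n' (fst (I ! k)))\<bar> / lam k)
              \<longlonglongrightarrow> \<bar>\<sigma> n (snd (I ! k)) - f (snd (I ! k)) - (\<sigma> n (fst (I ! k)) - f (fst (I ! k)))\<bar> / lam k"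
            using pos[of k] by (intro tendsto_intros f) auto
        qed
        have "Lambda_sum lam (\<lambda>x. \<sigma> n x - \<sigma> n' x) I \<le> e" if "N \<le> n'" for n'
          using Lambda_sum_le_var[OF fin[of n n'] I] N[OF n that]
          unfolding Lambda_dist_def Lambda_norm_def by linarith
        then show "\<forall>\<^sub>F n' in sequentially. Lambda_sum lam (\<lambda>x. \<sigma> n x - \<sigma> n' x) I \<le> e"
          by (auto simp: eventually_sequentially)
      qed simp
      have zero: "\<bar>\<sigma> n 0 - f 0\<bar> \<le> e" if n: "N \<le> n" for n
      proof (rule tendsto_upperbound)
        show "(\<lambda>n'. \<bar>\<sigma> n 0 - \<sigma> n' 0\<bar>) \<longlonglongrightarrow> \<bar>\<sigma> n 0 - f 0\<bar>" by (intro tendsto_intros f) simp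
        have "\<bar>\<sigma> n 0 - \<sigma> n' 0\<bar> \<le> e" if "N \<le> n'" for n'
          using N[OF n that] enn2real_nonneg[of "Lambda_var lam (\<lambda>x. \<sigma> n x - \<sigma> n' x)"]
          unfolding Lambda_dist_def Lambda_norm_def by linarith
        then show "\<forall>\<^sub>F n' in sequentially. \<bar>\<sigma> n 0 - \<sigma> n' 0\<bar> \<le> e"
          by (auto simp: eventually_sequentially)
      qed simp
      show ?thesis using var zero by (auto intro!: exI[of _ N] Lambda_var_leI)
    qed
    have "f \<in> Lambda_BV lam"
    proof -
      obtain n where "Lambda_var lam (\<lambda>x. \<sigma> n x - f x) \<le> ennreal 1" using close[of 1] by auto
      then have "Lambda_var lam (\<lambda>x. \<sigma> n x - f x) < \<infinity>" by (simp add: le_less_trans)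
      then have "Lambda_var lam f < \<infinity>"
        using \<sigma>[of n] Lambda_var_diff_finite[of lam "\<sigma> n" "\<lambda>x. \<sigma> n x - f x", OF pos]
        by (simp add: Lambda_BV_def)
      then show ?thesis by (simp add: Lambda_BV_def f_def)
    qed
    moreover have "\<exists>N. \<forall>n\<ge>N. \<sigma> n \<in> Lambda_BV lam \<and> Lambda_dist lam (\<sigma> n) f < \<epsilon>" if "0 < \<epsilon>" for \<epsilon>
    proof -
      obtain N where N: "\<And>n. N \<le> n \<Longrightarrow> Lambda_var lam (\<lambda>x. \<sigma> n x - f x) \<le> ennreal (\<epsilon> / 3)"
        "\<And>n. N \<le> n \<Longrightarrow> \<bar>\<sigma> n 0 - f 0\<bar> \<le> \<epsilon> / 3"
        using close[of "\<epsilon> / 3"] \<open>0 < \<epsilon>\<close> by auto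
      have "Lambda_dist lam (\<sigma> n) f < \<epsilon>" if "N \<le> n" for n
      proof -
        have "enn2real (Lambda_var lam (\<lambda>x. \<sigma> n x - f x)) \<le> \<epsilon> / 3"
          using N(1)[OF that] \<open>0 < \<epsilon>\<close> by (intro enn2real_leI) auto
        then show ?thesis
          using N(2)[OF that] \<open>0 < \<epsilon>\<close> unfolding Lambda_dist_def Lambda_norm_def by linarith
      qed
      then show ?thesis using \<sigma> by blast
    qed
    ultimately show "\<exists>f. limitin mtopology \<sigma> f sequentially"
      unfolding limit_metric_sequentially by blast
  qed
qed

text \<open>
  For a suitable \<open>n\<close> the distance of two functions of \<open>K\<close> is, up to a small error, that of their
  Bernstein polynomials, which is controlled by the values at the \<open>n + 1\<close> nodes. Rounding these
  values to multiples of \<open>\<delta>\<close> sorts \<open>K\<close> into finitely many cells of small diameter, and one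
  function from each cell gives a finite net.
\<close>

lemma mtotally_bounded_if_bernstein_uniform:
  assumes lam: "Lambda_seq lam" and K: "K \<subseteq> Lambda_BV lam"
    and bdd: "\<And>f. f \<in> K \<Longrightarrow> Lambda_norm lam f \<le> C"
    and approx: "\<And>e. 0 < e \<Longrightarrow> \<exists>n>0. \<forall>f\<in>K. Lambda_dist lam (bernstein_poly n f) f < e"
  shows "Metric_space.mtotally_bounded (Lambda_BV lam) (Lambda_dist lam) K"
proof -
  interpret Metric_space "Lambda_BV lam" "Lambda_dist lam" by (rule Metric_space_Lambda_BV[OF lam])
  have pos: "0 < lam 0" using lam by (rule Lambda_seq_pos)
  note BV = bernstein_poly_in_Lambda_BV[OF lam]
  show ?thesis
    unfolding mtotally_bounded_def
  proof (intro allI impI)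
    fix e :: real assume e: "0 < e"
    then obtain n where n: "0 < n" and appr: "\<And>f. f \<in> K \<Longrightarrow> Lambda_dist lam (bernstein_poly n f) f < e / 3"
      using approx[of "e / 3"] by auto
    define q where "q = 2 * real n / lam 0 + 1"
    have q: "0 < q" using pos by (simp add: q_def add_nonneg_pos)
    define \<delta> where "\<delta> = e / 3 / q"
    have \<delta>: "0 < \<delta>" "q * \<delta> = e / 3" using e q by (auto simp: \<delta>_def)
    define B where "B = (1 + lam 0) * C / \<delta>"
    define cell where "cell f = (\<lambda>k\<in>{..n}. \<lfloor>f (real k / real n) / \<delta>\<rfloor>)" for f
    have "cell f \<in> (\<Pi>\<^sub>E k\<in>{..n}. {\<lfloor>- B\<rfloor>..\<lfloor>B\<rfloor>})" if f: "f \<in> K" for f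
      unfolding cell_def
    proof (rule restrict_PiE_iff[THEN iffD2], rule ballI)
      fix k assume "k \<in> {..n}"
      then have "real k / real n \<in> {0..1}" using n by (auto simp: divide_le_eq)
      then have "\<bar>f (real k / real n)\<bar> \<le> (1 + lam 0) * Lambda_norm lam f"
        using f K by (intro abs_le_Lambda_norm lam) (auto simp: Lambda_BV_def)
      also have "\<dots> \<le> (1 + lam 0) * C" using bdd[OF f] pos by (intro mult_left_mono) auto
      finally have "\<bar>f (real k / real n) / \<delta>\<bar> \<le> B"
        using \<delta>(1) by (simp add: B_def divide_right_mono abs_divide)
      then have "- B \<le> f (real k / real n) / \<delta>" "f (real k / real n) / \<delta> \<le> B"
        unfolding abs_le_iff by linarith+
      then show "\<lfloor>f (real k / real n) / \<delta>\<rfloor> \<in> {\<lfloor>- B\<rfloor>..\<lfloor>B\<rfloor>}"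
        by (simp add: floor_mono)
    qed
    then have "cell ` K \<subseteq> (\<Pi>\<^sub>E k\<in>{..n}. {\<lfloor>- B\<rfloor>..\<lfloor>B\<rfloor>})" by blast
    then have "finite (cell ` K)" by (rule finite_subset) (intro finite_PiE, auto)
    then obtain F where F: "F \<subseteq> K" "finite F" "cell ` K = cell ` F"
      using finite_subset_image[of "cell ` K" cell K] by auto
    have "g \<in> (\<Union>f\<in>F. mball f e)" if g: "g \<in> K" for g
    proof -
      obtain f where f: "f \<in> F" "cell f = cell g" using F(3) g by (metis imageE imageI)
      have in_BV: "f \<in> Lambda_BV lam" "g \<in> Lambda_BV lam" using f F(1) g K by auto
      have "\<bar>f (real k / real n) - g (real k / real n)\<bar> \<le> \<delta>" if "k \<le> n" for k
      proof -
        have "cell f k = cell g k" using f(2) by simp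
        then have "\<lfloor>f (real k / real n) / \<delta>\<rfloor> = \<lfloor>g (real k / real n) / \<delta>\<rfloor>"
          using that by (simp add: cell_def)
        then have "\<bar>f (real k / real n) / \<delta> - g (real k / real n) / \<delta>\<bar> \<le> 1" by linarith
        then have "\<bar>f (real k / real n) - g (real k / real n)\<bar> / \<delta> \<le> 1"
          using \<delta>(1) by (simp add: diff_divide_distrib[symmetric])
        then show ?thesis using \<delta>(1) by (simp add: divide_le_eq)
      qed
      from Lambda_dist_bernstein_poly_le_nodes[of lam n f g \<delta>, OF lam n this]
      have "Lambda_dist lam (bernstein_poly n f) (bernstein_poly n g) \<le> e / 3"
        using \<delta>(2) by (simp add: q_def)
      moreover have "Lambda_dist lam f g \<le> Lambda_dist lam f (bernstein_poly n f)
          + Lambda_dist lam (bernstein_poly n f) (bernstein_poly n g) + Lambda_dist lam (bernstein_poly n g) g"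
        using triangle[OF in_BV(1) BV in_BV(2), of n f] triangle[OF BV BV in_BV(2), of n f n g] by linarith
      moreover have "Lambda_dist lam f (bernstein_poly n f) < e / 3"
        using appr[of f] f F(1) by (auto simp: commute)
      ultimately have "Lambda_dist lam f g < e" using appr[OF g] by linarith
      then show ?thesis using f in_BV by auto
    qed
    then show "\<exists>F. finite F \<and> F \<subseteq> K \<and> K \<subseteq> (\<Union>f\<in>F. mball f e)" using F by blast
  qed
qed

text \<open>
  Contractivity carries the convergence from a finite net to all of \<open>K\<close>.
\<close>

lemma bernstein_uniform_on_mtotally_bounded:
  assumes lam: "Lambda_seq lam" and K: "K \<subseteq> C_Lambda_BV_c lam"
    and tb: "Metric_space.mtotally_bounded (Lambda_BV lam) (Lambda_dist lam) K"
  shows "uniform_limit K (\<lambda>n f. Lambda_dist lam (bernstein_poly n f) f) (\<lambda>f. 0) sequentially"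
proof (rule uniform_limitI)
  interpret Metric_space "Lambda_BV lam" "Lambda_dist lam" by (rule Metric_space_Lambda_BV[OF lam])
  note BV = bernstein_poly_in_Lambda_BV[OF lam]
  fix e :: real assume e: "0 < e"
  have "0 < e / 3" using e by simp
  from tb[unfolded mtotally_bounded_def, rule_format, OF this]
  obtain F where F: "finite F" "F \<subseteq> K" "K \<subseteq> (\<Union>f\<in>F. mball f (e / 3))" by blast
  have "\<forall>\<^sub>F n in sequentially. \<forall>f\<in>F. Lambda_dist lam (bernstein_poly n f) f < e / 3"
  proof (intro eventually_ball_finite F(1) ballI)
    fix f assume "f \<in> F"
    then show "\<forall>\<^sub>F n in sequentially. Lambda_dist lam (bernstein_poly n f) f < e / 3"
      using F(2) K \<open>0 < e / 3\<close> by (intro order_tendstoD(2)[OF bernstein_poly_tendsto_Lambda_dist[OF lam]]) auto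
  qed
  then show "\<forall>\<^sub>F n in sequentially. \<forall>f\<in>K. dist (Lambda_dist lam (bernstein_poly n f) f) 0 < e"
    using eventually_gt_at_top[of 0]
  proof eventually_elim
    case (elim n)
    show ?case
    proof
      fix g assume "g \<in> K"
      then obtain f where f: "f \<in> F" "g \<in> mball f (e / 3)" using F(3) by blast
      then have fg: "f \<in> Lambda_BV lam" "g \<in> Lambda_BV lam" "Lambda_dist lam f g < e / 3" by auto
      have "Lambda_dist lam (bernstein_poly n g) g \<le> Lambda_dist lam (bernstein_poly n g) (bernstein_poly n f)
          + Lambda_dist lam (bernstein_poly n f) f + Lambda_dist lam f g"
        using triangle[OF BV BV fg(2), of n g n f] triangle[OF BV fg(1,2), of n f] by linarith
      moreover have "Lambda_dist lam (bernstein_poly n g) (bernstein_poly n f) \<le> Lambda_dist lam f g"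
        using Lambda_dist_bernstein_poly_le[OF lam elim(2) fg(2,1)] by (simp add: commute)
      moreover have "Lambda_dist lam (bernstein_poly n f) f < e / 3" using elim(1) f by blast
      ultimately have "Lambda_dist lam (bernstein_poly n g) g < e" using fg(3) by linarith
      then show "dist (Lambda_dist lam (bernstein_poly n g) g) 0 < e" by simp
    qed
  qed
qed

theorem corollary3:
  fixes lam :: "nat \<Rightarrow> real" and K :: "(real \<Rightarrow> real) set"
  assumes "proper_Lambda_seq lam"
    and "K \<subseteq> C_Lambda_BV_c lam"
    and "\<exists>C. \<forall>f \<in> K. Lambda_norm lam f \<le> C"
    and "closedin (Lambda_topology lam) K"
  shows "compactin (Lambda_topology lam) K \<longleftrightarrow>
    uniform_limit K (\<lambda>n f. Lambda_norm lam (\<lambda>x. bernstein_poly n f x - f x)) (\<lambda>f. 0) sequentially"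
proof -
  have lam: "Lambda_seq lam" using assms(1) by (simp add: proper_Lambda_seq_def)
  interpret Metric_space "Lambda_BV lam" "Lambda_dist lam" by (rule Metric_space_Lambda_BV[OF lam])
  have K: "K \<subseteq> Lambda_BV lam"
    using assms(2) by (auto simp: C_Lambda_BV_c_def continuous_in_Lambda_var_def)
  have "compactin (Lambda_topology lam) K \<longleftrightarrow> mtotally_bounded K"
    using mtotally_bounded_eq_compact_closure_of[OF mcomplete_Lambda_BV[OF lam], of K] K assms(4)
    by (simp add: Lambda_topology_def closure_of_closedin)
  also have "\<dots> \<longleftrightarrow> uniform_limit K (\<lambda>n f. Lambda_dist lam (bernstein_poly n f) f) (\<lambda>f. 0) sequentially"
  proof
    assume "mtotally_bounded K"
    with lam assms(2)
    show "uniform_limit K (\<lambda>n f. Lambda_dist lam (bernstein_poly n f) f) (\<lambda>f. 0) sequentially"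
      by (rule bernstein_uniform_on_mtotally_bounded)
  next
    assume lim: "uniform_limit K (\<lambda>n f. Lambda_dist lam (bernstein_poly n f) f) (\<lambda>f. 0) sequentially"
    obtain C where C: "\<And>f. f \<in> K \<Longrightarrow> Lambda_norm lam f \<le> C" using assms(3) by blast
    show "mtotally_bounded K"
    proof (rule mtotally_bounded_if_bernstein_uniform[OF lam K C])
      fix e :: real assume "0 < e"
      then have "\<forall>\<^sub>F n in sequentially. 0 < n \<and> (\<forall>f\<in>K. dist (Lambda_dist lam (bernstein_poly n f) f) 0 < e)"
        by (intro eventually_conj eventually_gt_at_top uniform_limitD[OF lim])
      then obtain n where "0 < n" "\<forall>f\<in>K. dist (Lambda_dist lam (bernstein_poly n f) f) 0 < e"
        unfolding eventually_sequentially by blast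
      then show "\<exists>n>0. \<forall>f\<in>K. Lambda_dist lam (bernstein_poly n f) f < e"
        by (auto intro!: exI[of _ n])
    qed
  qed
  finally show ?thesis by (simp add: Lambda_dist_def)
qed

end
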